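(* Let $\gamma_t=(p_t,\tau_t^2,\sigma_t^2,\delta_{0t},\delta_{At})$, $t=1,2,\dots$, be a sequence of parameter vectors such that, with $u=\tau^2/\sigma^2$, $f=(1-p)/p$, $\delta=\delta_0/\delta_A$ and $v=uf^2\delta^2$ (index $t$ suppressed), one has as $t\to\infty$: $p\to 0$, $u\to\infty$, $v\to\infty$ and $\frac{\log v}{u}\to C\in(0,\infty)$. Then the Bayes risk of the Bayes oracle takes the form $$R_{\mathrm{opt}}=mp\,\delta_A\left(2\Phi(\sqrt C)-1\right)(1+o_t).$$
   Context: Model. Given a number of tests $m\ge 1$ and parameters $p\in(0,1)$, $\sigma^2>0$, $\tau^2>0$, let $(\nu_i,X_i)$, $i=1,\dots,m$, be i.i.d. with $P(\nu_i=1)=p=1-P(\nu_i=0)$, $X_i\mid\nu_i=0\sim N(0,\sigma^2)$ and $X_i\mid\nu_i=1\sim N(0,\sigma^2+\tau^2)$. Only the $X_i$ are observed. The null hypothesis $H_{0i}$ is the event $\nu_i=0$, the alternative $H_{Ai}$ is $\nu_i=1$. A type I error (rejecting a true $H_{0i}$) costs $\delta_0>0$, a type II error (accepting $H_{0i}$ when $H_{Ai}$ holds) costs $\delta_A>0$, and the total loss is the sum over the $m$ tests. For a rule applying one fixed threshold in all tests the Bayes risk (expected total loss) is $R=m((1-p)t_1\delta_0+p\,t_2\delta_A)$ with $t_1,t_2$ the probabilities of type I and type II errors in a single test. Bayes oracle: the rule minimizing the Bayes risk; it rejects $H_{0i}$ iff $X_i^2/\sigma^2\ge(1+\frac1u)\left(\log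 v+\log(1+\frac1u)\right)$, where $u=\tau^2/\sigma^2$, $f=(1-p)/p$, $\delta=\delta_0/\delta_A$, $v=uf^2\delta^2$. Its Bayes risk is denoted $R_{\mathrm{opt}}$. $\Phi$ is the standard normal cumulative distribution function; $o_t$ denotes a term tending to $0$ as $t\to\infty$; the number of tests $m=m_t$ may vary with $t$. *)

theory Defs
  imports "HOL-Probability.Probability"
begin

text \<open>Model parameters; \<open>sigma2\<close> and \<open>tau2\<close> are variances, not standard deviations.\<close>

record params =
  prob_alt :: real
  tau2 :: real
  sigma2 :: real
  delta0 :: real
  deltaA :: real

definition valid_params :: "params \<Rightarrow> bool" where
  "valid_params \<gamma> \<longleftrightarrow> 0 < prob_alt \<gamma> \<and> prob_alt \<gamma> < 1 \<and> tau2 \<gamma> > 0 \<and> sigma2 \<gamma> > 0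
     \<and> delta0 \<gamma> > 0 \<and> deltaA \<gamma> > 0"

definition u_par :: "params \<Rightarrow> real" where
  "u_par \<gamma> = tau2 \<gamma> / sigma2 \<gamma>"

definition f_par :: "params \<Rightarrow> real" where
  "f_par \<gamma> = (1 - prob_alt \<gamma>) / prob_alt \<gamma>"

definition delta_par :: "params \<Rightarrow> real" where
  "delta_par \<gamma> = delta0 \<gamma> / deltaA \<gamma>"

definition v_par :: "params \<Rightarrow> real" where
  "v_par \<gamma> = u_par \<gamma> * (f_par \<gamma>)\<^sup>2 * (delta_par \<gamma>)\<^sup>2"

text \<open>Weighted normal densities: the joint density of the pair \<open>(\<nu>\<^sub>i, X\<^sub>i)\<close> of a single test,
  where \<open>True\<close> encodes \<open>\<nu>\<^sub>i = 1\<close> (the alternative). The lemma \<open>emeasure_test_law\<close> below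
  recovers the hierarchical description.\<close>

definition test_density :: "params \<Rightarrow> bool \<Rightarrow> real \<Rightarrow> real" where
  "test_density \<gamma> b x =
     (if b then prob_alt \<gamma> * normal_density 0 (sqrt (sigma2 \<gamma> + tau2 \<gamma>)) x
      else (1 - prob_alt \<gamma>) * normal_density 0 (sqrt (sigma2 \<gamma>)) x)"

definition test_law :: "params \<Rightarrow> (bool \<times> real) measure" where
  "test_law \<gamma> = density (count_space UNIV \<Otimes>\<^sub>M lborel) (\<lambda>(b, x). ennreal (test_density \<gamma> b x))"

text \<open>Law of the i.i.d. family \<open>(\<nu>\<^sub>i, X\<^sub>i)\<close>, \<open>i < m\<close>.\<close>

definition model :: "params \<Rightarrow> nat \<Rightarrow> (nat \<Rightarrow> bool \<times> real) measure" where
  "model \<gamma> m = PiM {..<m} (\<lambda>_. test_law \<gamma>)"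

definition hyps :: "nat \<Rightarrow> (nat \<Rightarrow> bool \<times> real) \<Rightarrow> nat \<Rightarrow> bool" where
  "hyps m w = (\<lambda>i\<in>{..<m}. fst (w i))"

definition obs :: "nat \<Rightarrow> (nat \<Rightarrow> bool \<times> real) \<Rightarrow> nat \<Rightarrow> real" where
  "obs m w = (\<lambda>i\<in>{..<m}. snd (w i))"

text \<open>A (multiple testing) rule maps the observed data \<open>x\<close> and a test index \<open>i\<close> to the decision
  whether to reject the \<open>i\<close>-th null hypothesis. The decision on test \<open>i\<close> may use all the data.\<close>

type_synonym rule = "(nat \<Rightarrow> real) \<Rightarrow> nat \<Rightarrow> bool"

definition measurable_rule :: "nat \<Rightarrow> rule \<Rightarrow> bool" where
  "measurable_rule m D \<longleftrightarrow>
     (\<forall>i<m. (\<lambda>x. D x i) \<in> measurable (PiM {..<m} (\<lambda>_. borel)) (count_space UNIV))"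

definition test_loss :: "params \<Rightarrow> bool \<Rightarrow> bool \<Rightarrow> real" where
  "test_loss \<gamma> alt reject =
     (if \<not> alt \<and> reject then delta0 \<gamma> else if alt \<and> \<not> reject then deltaA \<gamma> else 0)"

definition total_loss :: "params \<Rightarrow> nat \<Rightarrow> (nat \<Rightarrow> bool) \<Rightarrow> (nat \<Rightarrow> bool) \<Rightarrow> real" where
  "total_loss \<gamma> m alt reject = (\<Sum>i<m. test_loss \<gamma> (alt i) (reject i))"

definition bayes_risk :: "params \<Rightarrow> nat \<Rightarrow> rule \<Rightarrow> real" where
  "bayes_risk \<gamma> m D = (\<integral> w. total_loss \<gamma> m (hyps m w) (D (obs m w)) \<partial>model \<gamma> m)"

text \<open>That this rule minimizes the Bayes risk among all measurable rules is
  \<open>bayes_oracle_minimizes\<close> below.\<close>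

definition bayes_oracle :: "params \<Rightarrow> rule" where
  "bayes_oracle \<gamma> x i \<longleftrightarrow>
     (x i)\<^sup>2 / sigma2 \<gamma> \<ge> (1 + 1 / u_par \<gamma>) * (ln (v_par \<gamma>) + ln (1 + 1 / u_par \<gamma>))"

definition R_opt :: "params \<Rightarrow> nat \<Rightarrow> real" where
  "R_opt \<gamma> m = bayes_risk \<gamma> m (bayes_oracle \<gamma>)"

definition Phi :: "real \<Rightarrow> real" where
  "Phi = cdf std_normal_distribution"


lemma test_density_nonneg: "valid_params \<gamma> \<Longrightarrow> 0 \<le> test_density \<gamma> b x"
  by (auto simp: test_density_def valid_params_def)

lemma borel_measurable_test_density [measurable]:
  "(\<lambda>(b, x). ennreal (test_density \<gamma> b x)) \<in> borel_measurable (count_space UNIV \<Otimes>\<^sub>M lborel)"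
  unfolding test_density_def by measurable

lemma sets_test_law [measurable_cong]:
  "sets (test_law \<gamma>) = sets (count_space UNIV \<Otimes>\<^sub>M borel)"
  unfolding test_law_def sets_density by (intro sets_pair_measure_cong) auto

lemma nn_integral_test_law:
  assumes [measurable]: "g \<in> borel_measurable (count_space UNIV \<Otimes>\<^sub>M borel)"
  shows "(\<integral>\<^sup>+z. g z \<partial>test_law \<gamma>) =
    (\<integral>\<^sup>+x. ennreal (test_density \<gamma> True x) * g (True, x)
        + ennreal (test_density \<gamma> False x) * g (False, x) \<partial>lborel)"
proof -
  interpret C: sigma_finite_measure "count_space (UNIV :: bool set)"
    by (rule sigma_finite_measure_count_space_finite) simp
  interpret pair_sigma_finite "count_space (UNIV :: bool set)" "lborel :: real measure" ..
  have [measurable]: "g \<in> borel_measurable (count_space UNIV \<Otimes>\<^sub>M lborel)"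
    using assms measurable_cong_sets[OF sets_pair_measure_cong[OF refl sets_lborel] refl] by blast
  have "(\<integral>\<^sup>+z. g z \<partial>test_law \<gamma>) =
      (\<integral>\<^sup>+z. (case z of (b, x) \<Rightarrow> ennreal (test_density \<gamma> b x)) * g z
         \<partial>(count_space UNIV \<Otimes>\<^sub>M lborel))"
    unfolding test_law_def by (subst nn_integral_density) auto
  also have "\<dots> = (\<integral>\<^sup>+x. (\<integral>\<^sup>+b. ennreal (test_density \<gamma> b x) * g (b, x)
                      \<partial>count_space UNIV) \<partial>lborel)"
    by (subst nn_integral_snd[symmetric]) (auto simp: case_prod_beta)
  also have "\<dots> = (\<integral>\<^sup>+x. ennreal (test_density \<gamma> True x) * g (True, x)
        + ennreal (test_density \<gamma> False x) * g (False, x) \<partial>lborel)"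
    by (subst nn_integral_count_space_finite) (auto simp: UNIV_bool add.commute)
  finally show ?thesis .
qed

lemma emeasure_test_law:
  assumes "valid_params \<gamma>" and B: "B \<in> sets borel"
  shows "emeasure (test_law \<gamma>) ({True} \<times> B) = ennreal (prob_alt \<gamma>) *
      emeasure (density lborel (normal_density 0 (sqrt (sigma2 \<gamma> + tau2 \<gamma>)))) B"
    and "emeasure (test_law \<gamma>) ({False} \<times> B) = ennreal (1 - prob_alt \<gamma>) *
      emeasure (density lborel (normal_density 0 (sqrt (sigma2 \<gamma>)))) B"
proof -
  note [measurable] = B
  have S: "{b} \<times> B \<in> sets (test_law \<gamma>)" for b by measurable
  have *: "indicator ({b} \<times> B) (c, x) = (if b = c then indicator B x else (0::ennreal))" for b c x
    by (auto split: split_indicator)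
  have "emeasure (test_law \<gamma>) ({b} \<times> B) = (\<integral>\<^sup>+z. indicator ({b} \<times> B) z \<partial>test_law \<gamma>)" for b
    using S by simp
  also have "(\<integral>\<^sup>+z. indicator ({b} \<times> B) z \<partial>test_law \<gamma>) =
       (\<integral>\<^sup>+x. ennreal (test_density \<gamma> b x) * indicator B x \<partial>lborel)" for b
    by (subst nn_integral_test_law) (auto simp: * intro!: nn_integral_cong)
  finally have E: "emeasure (test_law \<gamma>) ({b} \<times> B) =
      (\<integral>\<^sup>+x. ennreal (test_density \<gamma> b x) * indicator B x \<partial>lborel)" for b .
  show "emeasure (test_law \<gamma>) ({True} \<times> B) = ennreal (prob_alt \<gamma>) *
      emeasure (density lborel (normal_density 0 (sqrt (sigma2 \<gamma> + tau2 \<gamma>)))) B"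
    using assms unfolding E test_density_def valid_params_def
    by (simp add: emeasure_density ennreal_mult mult.assoc nn_integral_cmult)
  show "emeasure (test_law \<gamma>) ({False} \<times> B) = ennreal (1 - prob_alt \<gamma>) *
      emeasure (density lborel (normal_density 0 (sqrt (sigma2 \<gamma>)))) B"
    using assms unfolding E test_density_def valid_params_def
    by (simp add: emeasure_density ennreal_mult mult.assoc nn_integral_cmult)
qed

lemma prob_space_test_law:
  assumes v: "valid_params \<gamma>"
  shows "prob_space (test_law \<gamma>)"
proof
  have sp: "space (test_law \<gamma>) = {True} \<times> UNIV \<union> {False} \<times> UNIV"
    using sets_eq_imp_space_eq[OF sets_test_law] by (auto simp: space_pair_measure)
  have S: "{b} \<times> UNIV \<in> sets (test_law \<gamma>)" for b by measurable
  have N: "emeasure (density lborel (normal_density 0 s)) UNIV = 1" if "s > 0" for s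
    using prob_space.emeasure_space_1[OF prob_space_normal_density[OF that, of 0]] by simp
  have "emeasure (test_law \<gamma>) (space (test_law \<gamma>)) =
      emeasure (test_law \<gamma>) ({True} \<times> UNIV) + emeasure (test_law \<gamma>) ({False} \<times> UNIV)"
    unfolding sp by (rule plus_emeasure[symmetric]) (auto simp: S)
  also have "\<dots> = ennreal (prob_alt \<gamma>) + ennreal (1 - prob_alt \<gamma>)"
    using v by (simp add: emeasure_test_law N valid_params_def)
  also have "\<dots> = 1"
    using v by (simp add: valid_params_def flip: ennreal_plus)
  finally show "emeasure (test_law \<gamma>) (space (test_law \<gamma>)) = 1" .
qed

lemma bayes_oracle_iff:
  assumes v: "valid_params \<gamma>"
  shows "bayes_oracle \<gamma> x i \<longleftrightarrow>
    test_density \<gamma> False (x i) * delta0 \<gamma> \<le> test_density \<gamma> True (x i) * deltaA \<gamma>"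
proof -
  define p where "p = prob_alt \<gamma>"
  define s where "s = sigma2 \<gamma>"
  define t where "t = tau2 \<gamma>"
  define d where "d = delta0 \<gamma>"
  define e where "e = deltaA \<gamma>"
  define y where "y = x i"
  note defs = p_def s_def t_def d_def e_def y_def
  have pos: "0 < p" "p < 1" "s > 0" "t > 0" "d > 0" "e > 0"
    using v unfolding valid_params_def defs by auto
  define A where "A = (1 - p) * d / sqrt (2 * pi * s)"
  define B where "B = p * e / sqrt (2 * pi * (s + t))"
  have AB: "A > 0" "B > 0" using pos by (auto simp: A_def B_def)
  have A2: "A\<^sup>2 = ((1 - p) * d)\<^sup>2 / (2 * pi * s)" and B2: "B\<^sup>2 = (p * e)\<^sup>2 / (2 * pi * (s + t))"
    using pos unfolding A_def B_def power_divide by simp_all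
  have c: "1 + 1 / u_par \<gamma> = (s + t) / t"
    using pos unfolding u_par_def defs[symmetric] by (simp add: field_simps)
  have vp: "v_par \<gamma> = t / s * ((1 - p) / p)\<^sup>2 * (d / e)\<^sup>2"
    unfolding v_par_def u_par_def f_par_def delta_par_def defs[symmetric] ..
  have "v_par \<gamma> * (1 + 1 / u_par \<gamma>) = A\<^sup>2 / B\<^sup>2"
    using pos unfolding c vp A2 B2 by (simp add: divide_simps power_mult_distrib)
  hence R: "v_par \<gamma> * (1 + 1 / u_par \<gamma>) = (A / B)\<^sup>2" by (simp add: power_divide)
  have vpos: "v_par \<gamma> > 0" using pos unfolding vp by simp
  have "ln (v_par \<gamma>) + ln (1 + 1 / u_par \<gamma>) = ln (v_par \<gamma> * (1 + 1 / u_par \<gamma>))"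
    using vpos pos unfolding c by (intro ln_mult_pos[symmetric]) auto
  also have "\<dots> = 2 * (ln A - ln B)"
    unfolding R using AB by (simp add: ln_realpow ln_div)
  finally have L: "ln (v_par \<gamma>) + ln (1 + 1 / u_par \<gamma>) = 2 * (ln A - ln B)" .
  have F: "test_density \<gamma> False y * d = A * exp (- y\<^sup>2 / (2 * s))"
    using pos unfolding test_density_def normal_density_def A_def defs(1,2)[symmetric] by simp
  have T: "test_density \<gamma> True y * e = B * exp (- y\<^sup>2 / (2 * (s + t)))"
    using pos unfolding test_density_def normal_density_def B_def defs(1-3)[symmetric] by simp
  have "test_density \<gamma> False y * d \<le> test_density \<gamma> True y * e \<longleftrightarrow>
      ln (A * exp (- y\<^sup>2 / (2 * s))) \<le> ln (B * exp (- y\<^sup>2 / (2 * (s + t))))"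
    unfolding F T using AB by (subst ln_le_cancel_iff) auto
  also have "\<dots> \<longleftrightarrow> ln A + - y\<^sup>2 / (2 * s) \<le> ln B + - y\<^sup>2 / (2 * (s + t))"
    using AB by (subst (1 2) ln_mult_pos) auto
  also have "\<dots> \<longleftrightarrow> 2 * (ln A - ln B) \<le> y\<^sup>2 / s - y\<^sup>2 / (s + t)"
  proof -
    have h: "- y\<^sup>2 / (2 * r) = - ((y\<^sup>2 / r) / 2)" for r :: real
      by simp
    have "a + - (b / 2) \<le> c + - (k / 2) \<longleftrightarrow> 2 * (a - c) \<le> b - k" for a b c k :: real
      by argo
    then show ?thesis unfolding h .
  qed
  also have "y\<^sup>2 / s - y\<^sup>2 / (s + t) = y\<^sup>2 / s / ((s + t) / t)"
  proof -
    have "s + t \<noteq> 0" using pos by simp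
    then show ?thesis using pos by (simp add: field_simps)
  qed
  also have "2 * (ln A - ln B) \<le> y\<^sup>2 / s / ((s + t) / t) \<longleftrightarrow>
      2 * (ln A - ln B) * ((s + t) / t) \<le> y\<^sup>2 / s"
    using pos by (intro pos_le_divide_eq) simp
  also have "2 * (ln A - ln B) * ((s + t) / t) = (s + t) / t * (2 * (ln A - ln B))"
    by (rule mult.commute)
  finally show ?thesis
    unfolding bayes_oracle_def L unfolding c defs by (rule sym)
qed

lemma measurable_bayes_oracle: "measurable_rule m (bayes_oracle \<gamma>)"
  unfolding measurable_rule_def
proof (intro allI impI)
  fix i assume "i < m"
  then have [measurable]: "(\<lambda>x. x i) \<in> borel_measurable (PiM {..<m} (\<lambda>_. borel :: real measure))"
    by (intro measurable_component_singleton) simp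
  show "(\<lambda>x. bayes_oracle \<gamma> x i) \<in> measurable (PiM {..<m} (\<lambda>_. borel)) (count_space UNIV)"
    unfolding bayes_oracle_def by measurable
qed

lemma measurable_test_loss:
  assumes D: "measurable_rule m D" and "i < m"
  shows "(\<lambda>w. test_loss \<gamma> (hyps m w i) (D (obs m w) i)) \<in> borel_measurable (model \<gamma> m)"
proof -
  have c: "(\<lambda>w. w j) \<in> measurable (model \<gamma> m) (count_space UNIV \<Otimes>\<^sub>M borel)" if "j < m" for j
    using measurable_component_singleton[of j "{..<m}" "\<lambda>_. test_law \<gamma>"] that
    unfolding model_def measurable_cong_sets[OF refl sets_test_law] by simp
  have "obs m \<in> measurable (model \<gamma> m) (PiM {..<m} (\<lambda>_. borel))"
    unfolding obs_def
    by (intro measurable_restrict measurable_compose[OF c measurable_snd]) simp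
  moreover have "(\<lambda>x. D x i) \<in> measurable (PiM {..<m} (\<lambda>_. borel)) (count_space UNIV)"
    using D \<open>i < m\<close> unfolding measurable_rule_def by blast
  ultimately have [measurable]: "(\<lambda>w. D (obs m w) i) \<in> measurable (model \<gamma> m) (count_space UNIV)"
    by (rule measurable_compose)
  have [measurable]: "(\<lambda>w. hyps m w i) \<in> measurable (model \<gamma> m) (count_space UNIV)"
    using measurable_compose[OF c[OF \<open>i < m\<close>] measurable_fst] \<open>i < m\<close>
    unfolding hyps_def by simp
  show ?thesis unfolding test_loss_def by measurable
qed

lemma test_loss_bounds:
  "valid_params \<gamma> \<Longrightarrow> 0 \<le> test_loss \<gamma> a r \<and> test_loss \<gamma> a r \<le> delta0 \<gamma> + deltaA \<gamma>"
  by (auto simp: test_loss_def valid_params_def)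

lemma nn_integral_test_loss:
  assumes v: "valid_params \<gamma>" and D: "measurable_rule m D" and i: "i < m"
  shows "(\<integral>\<^sup>+ w. test_loss \<gamma> (hyps m w i) (D (obs m w) i) \<partial>model \<gamma> m) =
    (\<integral>\<^sup>+ w. (\<integral>\<^sup>+x. ennreal (if D (obs m (w(i := (True, x)))) i
                          then test_density \<gamma> False x * delta0 \<gamma>
                          else test_density \<gamma> True x * deltaA \<gamma>) \<partial>lborel)
        \<partial>PiM ({..<m} - {i}) (\<lambda>_. test_law \<gamma>))"
proof -
  interpret prob_space "test_law \<gamma>" by (rule prob_space_test_law[OF v])
  interpret product_sigma_finite "\<lambda>_::nat. test_law \<gamma>" ..
  let ?g = "\<lambda>w. ennreal (test_loss \<gamma> (hyps m w i) (D (obs m w) i))"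
  have I: "insert i ({..<m} - {i}) = {..<m}" using i by auto
  have gm: "?g \<in> borel_measurable (PiM (insert i ({..<m} - {i})) (\<lambda>_. test_law \<gamma>))"
    using measurable_test_loss[OF D i] unfolding I model_def by simp
  have "(\<integral>\<^sup>+ w. ?g w \<partial>model \<gamma> m) = (\<integral>\<^sup>+ w. ?g w \<partial>PiM (insert i ({..<m} - {i})) (\<lambda>_. test_law \<gamma>))"
    unfolding I model_def ..
  also have "\<dots> = (\<integral>\<^sup>+ w. (\<integral>\<^sup>+z. ?g (w(i := z)) \<partial>test_law \<gamma>) \<partial>PiM ({..<m} - {i}) (\<lambda>_. test_law \<gamma>))"
    by (rule product_nn_integral_insert) (use gm in auto)
  also have "\<dots> = (\<integral>\<^sup>+ w. (\<integral>\<^sup>+x. ennreal (if D (obs m (w(i := (True, x)))) i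
                          then test_density \<gamma> False x * delta0 \<gamma>
                          else test_density \<gamma> True x * deltaA \<gamma>) \<partial>lborel)
        \<partial>PiM ({..<m} - {i}) (\<lambda>_. test_law \<gamma>))"
  proof (rule nn_integral_cong)
    fix w assume w: "w \<in> space (PiM ({..<m} - {i}) (\<lambda>_. test_law \<gamma>))"
    have "(\<lambda>z. w(i := z)) \<in> measurable (test_law \<gamma>) (PiM (insert i ({..<m} - {i})) (\<lambda>_. test_law \<gamma>))"
      using w by (intro measurable_component_update) auto
    from measurable_compose[OF this gm]
    have m: "(\<lambda>z. ?g (w(i := z))) \<in> borel_measurable (count_space UNIV \<Otimes>\<^sub>M borel)"
      by (simp cong: measurable_cong_sets add: measurable_cong_sets[OF sets_test_law refl])
    have o: "obs m (w(i := (b, x))) = obs m (w(i := (True, x)))" for b x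
      by (auto simp: obs_def fun_eq_iff)
    have h: "hyps m (w(i := (b, x))) i = b" for b x
      using i by (simp add: hyps_def)
    show "(\<integral>\<^sup>+z. ?g (w(i := z)) \<partial>test_law \<gamma>) =
      (\<integral>\<^sup>+x. ennreal (if D (obs m (w(i := (True, x)))) i
                          then test_density \<gamma> False x * delta0 \<gamma>
                          else test_density \<gamma> True x * deltaA \<gamma>) \<partial>lborel)"
      unfolding nn_integral_test_law[OF m]
    proof (rule nn_integral_cong)
      fix x :: real
      show "ennreal (test_density \<gamma> True x) * ?g (w(i := (True, x))) +
          ennreal (test_density \<gamma> False x) * ?g (w(i := (False, x))) =
        ennreal (if D (obs m (w(i := (True, x)))) i
                 then test_density \<gamma> False x * delta0 \<gamma> else test_density \<gamma> True x * deltaA \<gamma>)"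
        using v unfolding o[of False] h
        by (auto simp: test_loss_def ennreal_mult test_density_nonneg valid_params_def)
    qed
  qed
  finally show ?thesis .
qed

theorem bayes_oracle_minimizes:
  assumes v: "valid_params \<gamma>" and D: "measurable_rule m D"
  shows "bayes_risk \<gamma> m (bayes_oracle \<gamma>) \<le> bayes_risk \<gamma> m D"
proof -
  interpret T: prob_space "test_law \<gamma>" by (rule prob_space_test_law[OF v])
  interpret M: prob_space "model \<gamma> m"
    unfolding model_def by (rule prob_space_PiM) (rule T.prob_space_axioms)
  let ?l = "\<lambda>D i w. test_loss \<gamma> (hyps m w i) (D (obs m w) i)"
  have int: "integrable (model \<gamma> m) (?l E i)" if "measurable_rule m E" "i < m" for E i
    using measurable_test_loss[OF that] test_loss_bounds[OF v]
    by (intro M.integrable_const_bound[where B = "delta0 \<gamma> + deltaA \<gamma>"]) auto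
  have risk: "bayes_risk \<gamma> m E = (\<Sum>i<m. \<integral> w. ?l E i w \<partial>model \<gamma> m)" if "measurable_rule m E" for E
    unfolding bayes_risk_def total_loss_def using int[OF that]
    by (intro Bochner_Integration.integral_sum) auto
  note B = measurable_bayes_oracle[of m \<gamma>]
  have "(\<integral> w. ?l (bayes_oracle \<gamma>) i w \<partial>model \<gamma> m) \<le> (\<integral> w. ?l D i w \<partial>model \<gamma> m)" if i: "i < m" for i
  proof -
    have o: "obs m (w(i := (True, x))) i = x" for w x using i by (simp add: obs_def)
    have "(\<integral>\<^sup>+ w. ?l (bayes_oracle \<gamma>) i w \<partial>model \<gamma> m) \<le> (\<integral>\<^sup>+ w. ?l D i w \<partial>model \<gamma> m)"
      unfolding nn_integral_test_loss[OF v B i] nn_integral_test_loss[OF v D i]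
      by (intro nn_integral_mono ennreal_leI) (auto simp: bayes_oracle_iff[OF v] o)
    also have "(\<integral>\<^sup>+ w. ?l (bayes_oracle \<gamma>) i w \<partial>model \<gamma> m) =
        ennreal (\<integral> w. ?l (bayes_oracle \<gamma>) i w \<partial>model \<gamma> m)"
      using test_loss_bounds[OF v] by (intro nn_integral_eq_integral int[OF B i]) auto
    also have "(\<integral>\<^sup>+ w. ?l D i w \<partial>model \<gamma> m) = ennreal (\<integral> w. ?l D i w \<partial>model \<gamma> m)"
      using test_loss_bounds[OF v] by (intro nn_integral_eq_integral int[OF D i]) auto
    finally show ?thesis
      using test_loss_bounds[OF v] by (subst (asm) ennreal_le_iff) (auto intro!: integral_nonneg)
  qed
  then show ?thesis unfolding risk[OF B] risk[OF D] by (intro sum_mono) auto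
qed

end

theory Submission
  imports Defs
begin

text \<open>
  The loss is additive and the oracle decides each test from its own observation, so the risk is
  \<open>m\<close> times the risk of a single test. Let \<open>Z\<close> be standard normal and write
  \<open>q = (ln v + ln (1 + 1/u)) / u\<close> and \<open>c = (u + 1) q\<close>. Under the null hypothesis
  \<open>X\<^sup>2 / \<sigma>\<^sup>2\<close> has the law of \<open>Z\<^sup>2\<close>, under the alternative that of \<open>(1 + u) Z\<^sup>2\<close>; since the oracle
  rejects when \<open>X\<^sup>2 / \<sigma>\<^sup>2 \<ge> c\<close>, this gives (lemma \<open>R_opt_eq\<close>), after division by
  \<open>m p \<delta>\<^sub>A\<close>,

    \<open>R_opt / (m p \<delta>\<^sub>A) = f \<delta> P(Z\<^sup>2 \<ge> c) + P(Z\<^sup>2 < q)\<close>.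

  The type II term \<open>P(Z\<^sup>2 < q) = 2 \<Phi>(\<surd>q) - 1\<close> converges to \<open>2 \<Phi>(\<surd>C) - 1 > 0\<close>, because \<open>q \<longlongrightarrow> C\<close> and
  \<open>\<Phi>\<close> is continuous. The type I term is negligible (lemma \<open>type1_risk_bound\<close>): the tail bound
  \<open>P(Z\<^sup>2 \<ge> c) \<le> 2 exp(-c/2)\<close> and, once \<open>v \<ge> 1\<close>, \<open>c \<ge> ln v\<close> give \<open>P(Z\<^sup>2 \<ge> c) \<le> 2 / \<surd>v\<close>, while
  \<open>f \<delta> = \<surd>(v/u)\<close> by the definition of \<open>v\<close>, so the term is at most \<open>2 / \<surd>u\<close>.
\<close>

section \<open>Standard normal probabilities\<close>

abbreviation std_normal :: "real measure" where
  "std_normal \<equiv> std_normal_distribution"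

interpretation std_normal: real_distribution std_normal
  by (rule real_dist_normal_dist)

lemma emeasure_normal_scale:
  assumes s: "\<sigma> > 0" and [measurable]: "B \<in> sets borel"
  shows "emeasure (density lborel (normal_density 0 \<sigma>)) B = emeasure std_normal {z. \<sigma> * z \<in> B}"
proof -
  have [measurable]: "{z. \<sigma> * z \<in> B} \<in> sets borel"
    by measurable
  have d: "\<sigma> * normal_density 0 \<sigma> (\<sigma> * x) = std_normal_density x" for x
    using s by (simp add: normal_density_def real_sqrt_mult power_mult_distrib)
  have "emeasure (density lborel (normal_density 0 \<sigma>)) B
      = (\<integral>\<^sup>+x. ennreal (normal_density 0 \<sigma> x) * indicator B x \<partial>lborel)"
    by (subst emeasure_density) auto
  also have "\<dots> = ennreal \<sigma> *
      (\<integral>\<^sup>+x. ennreal (normal_density 0 \<sigma> (0 + \<sigma> * x)) * indicator B (0 + \<sigma> * x) \<partial>lborel)"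
    using s by (subst nn_integral_real_affine[where c = \<sigma> and t = 0]) auto
  also have "\<dots> = (\<integral>\<^sup>+x. ennreal (std_normal_density x) * indicator {z. \<sigma> * z \<in> B} x \<partial>lborel)"
    using s
    by (subst nn_integral_cmult[symmetric])
      (auto intro!: nn_integral_cong simp: d[symmetric] ennreal_mult mult.assoc split: split_indicator)
  also have "\<dots> = emeasure std_normal {z. \<sigma> * z \<in> B}"
    by (subst emeasure_density) auto
  finally show ?thesis .
qed

lemma std_normal_singleton: "measure std_normal {x} = 0"
proof -
  have "emeasure std_normal {x} = 0"
    by (subst emeasure_density)
      (auto simp: nn_integral_0_iff_AE split: split_indicator intro!: AE_I'[of "{x}"])
  then show ?thesis by (simp add: measure_def)
qed

lemma isCont_Phi: "isCont Phi x"
  unfolding Phi_def std_normal.isCont_cdf by (rule std_normal_singleton)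

lemma Phi_minus: "Phi (- x) = 1 - Phi x"
proof -
  have "emeasure std_normal {..x} = emeasure std_normal {- x..}"
  proof -
    have "emeasure std_normal {..x} = (\<integral>\<^sup>+y. ennreal (std_normal_density y) * indicator {..x} y \<partial>lborel)"
      by (subst emeasure_density) auto
    also have "\<dots> = (\<integral>\<^sup>+y. ennreal (std_normal_density (0 + (-1) * y)) * indicator {..x} (0 + (-1) * y) \<partial>lborel)"
      by (subst nn_integral_real_affine[where c = "-1" and t = 0]) auto
    also have "\<dots> = (\<integral>\<^sup>+y. ennreal (std_normal_density y) * indicator {- x..} y \<partial>lborel)"
      by (intro nn_integral_cong) (auto simp: std_normal_density_def split: split_indicator)
    also have "\<dots> = emeasure std_normal {- x..}"
      by (subst emeasure_density) auto
    finally show ?thesis .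
  qed
  then have "Phi x = measure std_normal {- x..}"
    unfolding Phi_def cdf_def by (simp add: measure_def)
  also have "{- x..} = (UNIV - {..- x}) \<union> {- x}" by auto
  also have "measure std_normal \<dots> = measure std_normal (UNIV - {..- x}) + measure std_normal {- x}"
    by (rule std_normal.finite_measure_Union) auto
  also have "\<dots> = 1 - Phi (- x)"
    using std_normal.prob_compl[of "{..- x}"] by (simp add: std_normal_singleton Phi_def cdf_def)
  finally show ?thesis by simp
qed

lemma std_normal_square_less:
  assumes "q \<ge> 0"
  shows "measure std_normal {z. z\<^sup>2 < q} = 2 * Phi (sqrt q) - 1"
proof (cases "q = 0")
  case True
  then show ?thesis using Phi_minus[of 0] by simp
next
  case False
  with assms have q: "sqrt q > 0" by simp
  have "z\<^sup>2 < q \<longleftrightarrow> \<bar>z\<bar> < sqrt q" for z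
    by (metis real_sqrt_abs real_sqrt_less_iff)
  then have "{z. z\<^sup>2 < q} = {z. \<bar>z\<bar> < sqrt q}"
    by (rule Collect_cong)
  also have "\<dots> = {- sqrt q<..<sqrt q}"
    by (simp add: set_eq_iff abs_less_iff minus_less_iff conj_commute)
  finally have "{z. z\<^sup>2 < q} = {- sqrt q<..<sqrt q}" .
  moreover have "measure std_normal {- sqrt q<..sqrt q} =
      measure std_normal {- sqrt q<..<sqrt q} + measure std_normal {sqrt q}"
  proof -
    have eq: "{- sqrt q<..sqrt q} = {- sqrt q<..<sqrt q} \<union> {sqrt q}" using q by auto
    show ?thesis unfolding eq by (rule std_normal.finite_measure_Union) auto
  qed
  ultimately show ?thesis
    using std_normal.cdf_diff_eq[of "- sqrt q" "sqrt q"] q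
    by (simp add: std_normal_singleton Phi_minus flip: Phi_def)
qed

lemma two_Phi_minus_one_pos:
  assumes "x > 0"
  shows "2 * Phi x - 1 > 0"
proof -
  have "ennreal (std_normal_density x) * ennreal x
      = (\<integral>\<^sup>+y. ennreal (std_normal_density x) * indicator {0<..x} y \<partial>lborel)"
    using assms by (subst nn_integral_cmult_indicator) auto
  also have "\<dots> \<le> (\<integral>\<^sup>+y. ennreal (std_normal_density y) * indicator {0<..x} y \<partial>lborel)"
    by (intro nn_integral_mono)
      (auto simp: std_normal_density_def power_mono divide_right_mono split: split_indicator intro!: ennreal_leI)
  also have "\<dots> = emeasure std_normal {0<..x}"
    by (subst emeasure_density) auto
  also have "\<dots> = ennreal (Phi x - Phi 0)"
    using std_normal.cdf_diff_eq[OF assms] by (simp add: std_normal.emeasure_eq_measure Phi_def)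
  finally have "ennreal (std_normal_density x * x) \<le> ennreal (Phi x - Phi 0)"
    using assms by (simp add: ennreal_mult)
  moreover have "std_normal_density x * x > 0"
    using assms by (simp add: normal_density_pos)
  ultimately have "Phi x - Phi 0 > 0"
    by (metis ennreal_le_iff2 less_le_trans not_le)
  then show ?thesis using Phi_minus[of 0] by simp
qed

text \<open>The constant 2 is not optimal, and no factor \<open>1 / sqrt c\<close> is extracted; neither is needed. On the
  event \<open>c \<le> z\<^sup>2\<close> the density is dominated by \<open>exp (- c / 2)\<close> times the sum of the two unit-variance
  normal densities centred at \<open>\<plusminus> sqrt c\<close>, each of total mass 1.\<close>

lemma std_normal_tail:
  assumes c: "c \<ge> 0"
  shows "measure std_normal {z. c \<le> z\<^sup>2} \<le> 2 * exp (- c / 2)"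
proof -
  define a where "a = sqrt c"
  have a: "a \<ge> 0" "a\<^sup>2 = c" using c by (auto simp: a_def)
  have I: "(\<integral>\<^sup>+x. ennreal (normal_density \<mu> 1 x) \<partial>lborel) = 1" for \<mu>
    by (simp add: nn_integral_eq_integral)
  have P: "std_normal_density x \<le> exp (- c / 2) * (normal_density a 1 x + normal_density (- a) 1 x)"
    if x: "c \<le> x\<^sup>2" for x
  proof -
    have "exp (- x\<^sup>2 / 2) \<le> exp (- c / 2) * (exp (- (x - a)\<^sup>2 / 2) + exp (- (x + a)\<^sup>2 / 2))"
    proof -
      have ax: "a \<le> \<bar>x\<bar>" using x unfolding a_def by (metis real_sqrt_abs real_sqrt_le_iff)
      consider "a \<le> x" | "x \<le> - a" using ax by linarith
      then show ?thesis
      proof cases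
        case 1
        have "a * a \<le> a * x" using 1 a by (intro mult_left_mono)
        then have "- x\<^sup>2 / 2 \<le> - c / 2 + - (x - a)\<^sup>2 / 2"
          unfolding a(2)[symmetric] by (simp add: power2_eq_square algebra_simps)
        then have "exp (- x\<^sup>2 / 2) \<le> exp (- c / 2) * exp (- (x - a)\<^sup>2 / 2)"
          by (simp only: exp_add[symmetric] exp_le_cancel_iff)
        then show ?thesis by (simp add: distrib_left add_increasing2)
      next
        case 2
        have "a * a \<le> a * (- x)" using 2 a by (intro mult_left_mono) auto
        then have "- x\<^sup>2 / 2 \<le> - c / 2 + - (x + a)\<^sup>2 / 2"
          unfolding a(2)[symmetric] by (simp add: power2_eq_square algebra_simps)
        then have "exp (- x\<^sup>2 / 2) \<le> exp (- c / 2) * exp (- (x + a)\<^sup>2 / 2)"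
          by (simp only: exp_add[symmetric] exp_le_cancel_iff)
        then show ?thesis by (simp add: distrib_left add_increasing)
      qed
    qed
    from mult_left_mono[OF this, of "1 / sqrt (2 * pi)"] show ?thesis
      by (simp add: normal_density_def algebra_simps)
  qed
  have [measurable]: "{z::real. c \<le> z\<^sup>2} \<in> sets borel" by measurable
  have "emeasure std_normal {z. c \<le> z\<^sup>2}
      = (\<integral>\<^sup>+x. ennreal (std_normal_density x) * indicator {z. c \<le> z\<^sup>2} x \<partial>lborel)"
    by (subst emeasure_density) auto
  also have "\<dots> \<le> (\<integral>\<^sup>+x. ennreal (exp (- c / 2)) *
      (ennreal (normal_density a 1 x) + ennreal (normal_density (- a) 1 x)) \<partial>lborel)"
    using P by (intro nn_integral_mono)
      (auto simp flip: ennreal_plus ennreal_mult split: split_indicator intro!: ennreal_leI)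
  also have "\<dots> = ennreal (2 * exp (- c / 2))"
    by (subst nn_integral_cmult, simp, subst nn_integral_add) (auto simp: I ennreal_mult mult.commute)
  finally show ?thesis by (simp add: std_normal.emeasure_eq_measure)
qed

section \<open>The risk of the oracle\<close>

text \<open>The critical value of the oracle for the statistic \<open>X\<^sup>2 / \<sigma>\<^sup>2\<close>.\<close>

definition oracle_threshold :: "params \<Rightarrow> real" where
  "oracle_threshold \<gamma> = (1 + 1 / u_par \<gamma>) * (ln (v_par \<gamma>) + ln (1 + 1 / u_par \<gamma>))"

text \<open>The two probabilities are those of the type I and the type II error of a single test. Rescaling to
  the standard normal law turns the threshold \<open>c\<close> into \<open>c / (1 + u)\<close> under the alternative,
  which is the quotient in the second probability.\<close>

lemma R_opt_eq:
  assumes v: "valid_params \<gamma>"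
  shows "R_opt \<gamma> m = real m *
    ((1 - prob_alt \<gamma>) * delta0 \<gamma> * measure std_normal {z. oracle_threshold \<gamma> \<le> z\<^sup>2}
     + prob_alt \<gamma> * deltaA \<gamma> *
       measure std_normal {z. z\<^sup>2 < (ln (v_par \<gamma>) + ln (1 + 1 / u_par \<gamma>)) / u_par \<gamma>})"
proof -
  interpret T: prob_space "test_law \<gamma>" by (rule prob_space_test_law[OF v])
  interpret M: prob_space "model \<gamma> m"
    unfolding model_def by (rule prob_space_PiM) (rule T.prob_space_axioms)
  let ?D = "bayes_oracle \<gamma>"
  let ?l = "\<lambda>i w. test_loss \<gamma> (hyps m w i) (?D (obs m w) i)"
  define c where "c = oracle_threshold \<gamma>"
  define q where "q = (ln (v_par \<gamma>) + ln (1 + 1 / u_par \<gamma>)) / u_par \<gamma>"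
  define s where "s = sigma2 \<gamma>"
  define t where "t = tau2 \<gamma>"
  define p where "p = prob_alt \<gamma>"
  define r where "r = (1 - p) * delta0 \<gamma> * measure std_normal {z. c \<le> z\<^sup>2}
     + p * deltaA \<gamma> * measure std_normal {z. z\<^sup>2 < q}"
  have pos: "s > 0" "t > 0" "0 < p" "p < 1" "delta0 \<gamma> > 0" "deltaA \<gamma> > 0"
    using v unfolding valid_params_def s_def t_def p_def by auto
  have r0: "r \<ge> 0" using pos by (simp add: r_def)
  note B = measurable_bayes_oracle[of m \<gamma>]
  \<comment> \<open>The rejection region of a single test, in terms of its observation.\<close>
  define S where "S = {x. c \<le> x\<^sup>2 / s}"
  have [measurable]: "S \<in> sets borel" unfolding S_def by measurable
  have S0: "{z. sqrt s * z \<in> S} = {z. c \<le> z\<^sup>2}"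
    using pos by (simp add: S_def power_mult_distrib)
  have S1: "{z. sqrt (s + t) * z \<in> - S} = {z. z\<^sup>2 < q}"
  proof -
    have cq: "c = (s + t) / s * q"
      using pos unfolding c_def q_def oracle_threshold_def u_par_def s_def[symmetric] t_def[symmetric]
      by (simp add: field_simps)
    have "(s + t) * z\<^sup>2 / s < (s + t) / s * q \<longleftrightarrow> z\<^sup>2 < q" for z
      using pos mult_less_cancel_left_pos[of "(s + t) / s" "z\<^sup>2" q] by simp
    then show ?thesis using pos by (auto simp: S_def power_mult_distrib cq not_le)
  qed
  have inner: "(\<integral>\<^sup>+x. ennreal (if x \<in> S then test_density \<gamma> False x * delta0 \<gamma>
      else test_density \<gamma> True x * deltaA \<gamma>) \<partial>lborel) = ennreal r"
  proof -
    have "(\<integral>\<^sup>+x. ennreal (if x \<in> S then test_density \<gamma> False x * delta0 \<gamma>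
        else test_density \<gamma> True x * deltaA \<gamma>) \<partial>lborel)
      = (\<integral>\<^sup>+x. ennreal ((1 - p) * delta0 \<gamma>) * (ennreal (normal_density 0 (sqrt s) x) * indicator S x)
        + ennreal (p * deltaA \<gamma>) * (ennreal (normal_density 0 (sqrt (s + t)) x) * indicator (- S) x) \<partial>lborel)"
      using pos by (intro nn_integral_cong)
        (auto simp: test_density_def s_def t_def p_def algebra_simps simp flip: ennreal_mult)
    also have "\<dots> = ennreal ((1 - p) * delta0 \<gamma>) * emeasure (density lborel (normal_density 0 (sqrt s))) S
        + ennreal (p * deltaA \<gamma>) * emeasure (density lborel (normal_density 0 (sqrt (s + t)))) (- S)"
      by (subst nn_integral_add, simp, simp) (simp add: nn_integral_cmult emeasure_density)
    also have "\<dots> = ennreal r"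
      using pos unfolding r_def
      by (simp add: emeasure_normal_scale S0 S1 std_normal.emeasure_eq_measure ennreal_mult
          del: Compl_iff)
    finally show ?thesis .
  qed
  have E: "(\<integral> w. ?l i w \<partial>model \<gamma> m) = r" if i: "i < m" for i
  proof -
    interpret P: prob_space "PiM ({..<m} - {i}) (\<lambda>_. test_law \<gamma>)"
      by (rule prob_space_PiM) (rule T.prob_space_axioms)
    have o: "?D (obs m (w(i := (True, x)))) i \<longleftrightarrow> x \<in> S" for w x
      using i by (simp add: obs_def bayes_oracle_def S_def c_def s_def oracle_threshold_def)
    have "(\<integral>\<^sup>+ w. ?l i w \<partial>model \<gamma> m) = ennreal r"
      unfolding nn_integral_test_loss[OF v B i] o inner by (simp add: P.emeasure_space_1)
    then show ?thesis
      using r0 test_loss_bounds[OF v] measurable_test_loss[OF B i]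
      by (subst integral_eq_nn_integral) auto
  qed
  have int: "integrable (model \<gamma> m) (?l i)" if "i < m" for i
    using measurable_test_loss[OF B that] test_loss_bounds[OF v]
    by (intro M.integrable_const_bound[where B = "delta0 \<gamma> + deltaA \<gamma>"]) auto
  have "R_opt \<gamma> m = (\<Sum>i<m. \<integral> w. ?l i w \<partial>model \<gamma> m)"
    unfolding R_opt_def bayes_risk_def total_loss_def using int
    by (intro Bochner_Integration.integral_sum) auto
  also have "\<dots> = real m * r" by (simp add: E)
  finally show ?thesis unfolding r_def c_def q_def p_def .
qed

text \<open>The left-hand side is the type I part of the risk of a single test, relative to \<open>p \<delta>\<^sub>A\<close>.\<close>

lemma type1_risk_bound:
  assumes v: "valid_params \<gamma>" and v1: "v_par \<gamma> \<ge> 1"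
  shows "f_par \<gamma> * delta_par \<gamma> * measure std_normal {z. oracle_threshold \<gamma> \<le> z\<^sup>2}
    \<le> 2 / sqrt (u_par \<gamma>)"
proof -
  define u where "u = u_par \<gamma>"
  define V where "V = v_par \<gamma>"
  define g where "g = f_par \<gamma> * delta_par \<gamma>"
  have u: "u > 0" and g: "g > 0"
    using v unfolding u_def g_def u_par_def f_par_def delta_par_def valid_params_def by auto
  have V: "V = u * g\<^sup>2" "V \<ge> 1"
    using v1 by (auto simp: V_def g_def u_def v_par_def power_mult_distrib)
  have L: "ln V \<ge> 0" "ln (1 + 1 / u) \<ge> 0" using V u by auto
  have c: "oracle_threshold \<gamma> \<ge> ln V"
  proof -
    have "1 * (ln V + 0) \<le> (1 + 1 / u) * (ln V + ln (1 + 1 / u))"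
      using L u by (intro mult_mono) auto
    then show ?thesis by (simp add: oracle_threshold_def u_def V_def)
  qed
  have "exp (- oracle_threshold \<gamma> / 2) \<le> exp (- (ln V / 2))" using c by simp
  also have "\<dots> = 1 / sqrt V"
    using V by (simp add: exp_minus ln_sqrt[symmetric] inverse_eq_divide)
  also have "sqrt V = sqrt u * g" using g by (simp add: V(1) real_sqrt_mult)
  finally have e: "exp (- oracle_threshold \<gamma> / 2) \<le> 1 / (sqrt u * g)" .
  have "measure std_normal {z. oracle_threshold \<gamma> \<le> z\<^sup>2} \<le> 2 * exp (- oracle_threshold \<gamma> / 2)"
    using c L by (intro std_normal_tail) auto
  also have "\<dots> \<le> 2 * (1 / (sqrt u * g))" using e by simp
  finally have "g * measure std_normal {z. oracle_threshold \<gamma> \<le> z\<^sup>2} \<le> g * (2 * (1 / (sqrt u * g)))"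
    using g by (intro mult_left_mono) auto
  then show ?thesis using g by (simp add: u_def[symmetric] g_def[symmetric])
qed

section \<open>The asymptotic risk\<close>

theorem theorem3p1:
  fixes \<gamma> :: "nat \<Rightarrow> params" and m :: "nat \<Rightarrow> nat" and C :: real
  assumes "\<And>t. valid_params (\<gamma> t)"
    and "\<And>t. m t \<ge> 1"
    and "(\<lambda>t. prob_alt (\<gamma> t)) \<longlonglongrightarrow> 0"
    and "filterlim (\<lambda>t. u_par (\<gamma> t)) at_top sequentially"
    and "filterlim (\<lambda>t. v_par (\<gamma> t)) at_top sequentially"
    and "(\<lambda>t. ln (v_par (\<gamma> t)) / u_par (\<gamma> t)) \<longlonglongrightarrow> C"
    and "C > 0"
  shows "\<exists>\<epsilon> :: nat \<Rightarrow> real. \<epsilon> \<longlonglongrightarrow> 0 \<and>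
    (\<forall>t. R_opt (\<gamma> t) (m t) =
       real (m t) * prob_alt (\<gamma> t) * deltaA (\<gamma> t) * (2 * Phi (sqrt C) - 1) * (1 + \<epsilon> t))"
proof -
  define K where "K = 2 * Phi (sqrt C) - 1"
  have K: "K > 0" unfolding K_def using assms(7) by (intro two_Phi_minus_one_pos) simp
  \<comment> \<open>Type I and type II parts of the risk, relative to \<open>m p \<delta>\<^sub>A\<close>.\<close>
  define A where "A t = f_par (\<gamma> t) * delta_par (\<gamma> t) *
    measure std_normal {z. oracle_threshold (\<gamma> t) \<le> z\<^sup>2}" for t
  define q where "q t = (ln (v_par (\<gamma> t)) + ln (1 + 1 / u_par (\<gamma> t))) / u_par (\<gamma> t)" for t
  define B where "B t = measure std_normal {z. z\<^sup>2 < q t}" for t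
  have R: "R_opt (\<gamma> t) (m t) = real (m t) * prob_alt (\<gamma> t) * deltaA (\<gamma> t) * (A t + B t)" for t
    using assms(1)[of t]
    by (simp add: R_opt_eq A_def B_def q_def f_par_def delta_par_def valid_params_def field_simps)
  have v1: "\<forall>\<^sub>F t in sequentially. v_par (\<gamma> t) \<ge> 1"
    using assms(5) by (simp add: filterlim_at_top)
  have inv: "(\<lambda>t. 1 / u_par (\<gamma> t)) \<longlonglongrightarrow> 0"
    by (rule real_tendsto_divide_at_top[OF tendsto_const assms(4)])
  have "(\<lambda>t. 2 / sqrt (u_par (\<gamma> t))) \<longlonglongrightarrow> 0"
    by (rule real_tendsto_divide_at_top[OF tendsto_const filterlim_compose[OF sqrt_at_top assms(4)]])
  moreover have "\<forall>\<^sub>F t in sequentially. 0 \<le> A t"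
    using assms(1)
    by (intro always_eventually)
      (auto simp: A_def f_par_def delta_par_def valid_params_def less_imp_le)
  moreover have "\<forall>\<^sub>F t in sequentially. A t \<le> 2 / sqrt (u_par (\<gamma> t))"
    using v1 by eventually_elim (auto simp: A_def intro: type1_risk_bound assms(1))
  ultimately have A: "A \<longlonglongrightarrow> 0"
    by (intro tendsto_sandwich[of "\<lambda>_. 0" A sequentially "\<lambda>t. 2 / sqrt (u_par (\<gamma> t))" 0] tendsto_const)
  have "(\<lambda>t. ln (1 + 1 / u_par (\<gamma> t))) \<longlonglongrightarrow> ln (1 + 0)"
    by (intro tendsto_intros inv) simp
  then have "(\<lambda>t. ln (1 + 1 / u_par (\<gamma> t)) / u_par (\<gamma> t)) \<longlonglongrightarrow> 0"
    by (rule real_tendsto_divide_at_top[OF _ assms(4)])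
  then have q: "q \<longlonglongrightarrow> C"
    using tendsto_add[OF assms(6), of _ 0] by (simp add: q_def[abs_def] add_divide_distrib)
  then have "(\<lambda>t. Phi (sqrt (q t))) \<longlonglongrightarrow> Phi (sqrt C)"
    by (intro isCont_tendsto_compose[OF isCont_Phi] tendsto_real_sqrt)
  then have "(\<lambda>t. 2 * Phi (sqrt (q t)) - 1) \<longlonglongrightarrow> K"
    unfolding K_def by (intro tendsto_intros)
  moreover have "\<forall>\<^sub>F t in sequentially. 2 * Phi (sqrt (q t)) - 1 = B t"
    using order_tendstoD(1)[OF q assms(7)]
    by eventually_elim (simp add: B_def std_normal_square_less)
  ultimately have B: "B \<longlonglongrightarrow> K" by (rule Lim_transform_eventually)
  have "(\<lambda>t. (A t + B t) / K - 1) \<longlonglongrightarrow> (0 + K) / K - 1"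
    using K by (intro tendsto_intros A B) simp
  then have "(\<lambda>t. (A t + B t) / K - 1) \<longlonglongrightarrow> 0" using K by simp
  moreover have "R_opt (\<gamma> t) (m t) = real (m t) * prob_alt (\<gamma> t) * deltaA (\<gamma> t) *
      (2 * Phi (sqrt C) - 1) * (1 + ((A t + B t) / K - 1))" for t
    using K by (simp add: R K_def[symmetric])
  ultimately show ?thesis by blast
qed

end
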